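(* Let $K=\mathbb{Q}(\sqrt{D})$ with $D\geq 2$ a squarefree integer, let $\mathcal{O}$ be the ring of integers of $K$, and let $\mathcal{O}^+$ be the set of totally positive elements of $\mathcal{O}$. Then every element of $2\mathcal{O}^+=\{2\alpha:\alpha\in\mathcal{O}^+\}$ is a sum of (finitely many) squares of elements of $\mathcal{O}$ if and only if $D=2$, $D=3$, or $D=5$.
   Context: An element $\alpha\in K$ is totally positive if $\sigma(\alpha)>0$ for every embedding $\sigma:K\hookrightarrow\mathbb{R}$ (that is, both $\alpha$ and its conjugate $\alpha'$ are positive). *)

theory Defs
  imports
    Complex_Main
    "HOL-Computational_Algebra.Polynomial"
    "HOL-Computational_Algebra.Squarefree"
begin

(* The field K = Q(sqrt D), realised as a subfield of the reals. *)
definition quad_field :: "int \<Rightarrow> real set" where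
  "quad_field D = {of_rat a + of_rat b * sqrt (of_int D) | a b. True}"

definition ring_of_integers :: "real set \<Rightarrow> real set" where
  "ring_of_integers K = {x \<in> K. algebraic_int x}"

(* A field embedding of K into the reals.  Only the restriction of \<sigma> to K matters;
   its values outside K are unconstrained. *)
definition real_embedding :: "real set \<Rightarrow> (real \<Rightarrow> real) \<Rightarrow> bool" where
  "real_embedding K \<sigma> \<longleftrightarrow>
     \<sigma> 1 = 1 \<and>
     (\<forall>x\<in>K. \<forall>y\<in>K. \<sigma> (x + y) = \<sigma> x + \<sigma> y) \<and>
     (\<forall>x\<in>K. \<forall>y\<in>K. \<sigma> (x * y) = \<sigma> x * \<sigma> y) \<and>
     inj_on \<sigma> K"

definition totally_positive :: "real set \<Rightarrow> real \<Rightarrow> bool" where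
  "totally_positive K \<alpha> \<longleftrightarrow> (\<forall>\<sigma>. real_embedding K \<sigma> \<longrightarrow> \<sigma> \<alpha> > 0)"

definition totally_positive_integers :: "real set \<Rightarrow> real set" where
  "totally_positive_integers K = {\<alpha> \<in> ring_of_integers K. totally_positive K \<alpha>}"

definition sum_of_squares :: "real set \<Rightarrow> real \<Rightarrow> bool" where
  "sum_of_squares R x \<longleftrightarrow>
     (\<exists>ys. set ys \<subseteq> R \<and> x = sum_list (map (\<lambda>y. y ^ 2) ys))"

end

theory Submission
  imports Defs
begin

text \<open>
  Write \<open>w = sqrt D\<close>. The integers of \<open>K\<close> are the numbers \<open>(a + b w) / 2\<close> with integers \<open>a, b\<close>
  such that 4 divides \<open>a^2 - D b^2\<close> (\<open>ring_of_integers_memI\<close>, \<open>ring_of_integers_memE\<close>); such a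
  number is totally positive iff \<open>a > 0\<close> and \<open>a^2 > D b^2\<close> (\<open>totally_positive_iff\<close>). Its double is
  \<open>a + b w\<close>, so the question is which \<open>a + b w\<close> in this cone are sums of squares.

  Necessity rests on the size of traces. If \<open>a + b w\<close> is the sum of the squares of
  \<open>(x + y w) / 2\<close>, then \<open>4 a = \<Sum> x^2 + D \<Sum> y^2\<close> and \<open>2 b = \<Sum> x y\<close>. For \<open>b \<noteq> 0\<close> some \<open>y\<close> is nonzero,
  so \<open>a\<close> has to be at least of order \<open>D\<close>. But the cone contains elements with \<open>b\<close> equal to 1 or 2
  and \<open>a\<close> of order \<open>w\<close>. Comparing the two bounds, with the parity of \<open>x\<close> and \<open>y\<close> taken into
  account, leaves only 2, 3 and 5 (\<open>doubles_sums_of_squares_imp\<close>).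

  Sufficiency is a descent (\<open>unit_square_descent\<close>). Multiplication by the square of a unit preserves
  sums of squares and the cone, and it lowers \<open>a\<close> unless \<open>a \<ge> c |b|\<close> for a constant \<open>c\<close> that
  depends on the unit. In this smaller cone \<open>a + b w\<close> is a natural multiple of 1 plus a natural
  multiple of \<open>k (c + w)\<close> or of \<open>k (c - w)\<close>, where \<open>k\<close> is the least possible positive value of \<open>b\<close>,
  and explicit squares for the latter finish the proof:
  \<open>2 (2 + w) = (1 + w)^2 + 1\<close> for \<open>D = 2\<close>, \<open>2 (2 + w) = (1 + w)^2\<close> for \<open>D = 3\<close>, and
  \<open>5 + w = 2 (((1 + w) / 2)^2 + 1)\<close> for \<open>D = 5\<close>.
\<close>

section \<open>The field and its conjugation\<close>

lemma squarefree_nonsquare: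
  fixes D s :: int
  assumes "D \<ge> 2" "squarefree D"
  shows "s^2 \<noteq> D"
proof
  assume "s^2 = D"
  with assms(2) have "s dvd 1" by (auto simp: squarefree_def)
  then have "s^2 = 1" by (auto simp: power2_eq_1_iff abs_if split: if_splits)
  with \<open>s^2 = D\<close> assms(1) show False by simp
qed

lemma sqrt_squarefree_irrational:
  fixes D :: int
  assumes "D \<ge> 2" "squarefree D"
  shows "sqrt (of_int D) \<notin> \<rat>"
proof
  assume "sqrt (of_int D) \<in> \<rat>"
  then have "sqrt (of_int D) \<in> \<int>"
    by (intro rational_algebraic_int_is_int) auto
  then obtain s :: int where s: "sqrt (of_int D) = of_int s" by (auto simp: Ints_def)
  then have "(of_int s :: real)^2 = of_int D"
    using assms(1) by (metis of_int_0_le_iff order_trans real_sqrt_pow2 zero_le_numeral)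
  then have "s^2 = D" by (metis of_int_eq_iff of_int_power)
  with squarefree_nonsquare[OF assms] show False by blast
qed

lemma quad_coords_unique:
  fixes D :: int and r s r' s' :: rat
  assumes "D \<ge> 2" "squarefree D"
    and "of_rat r + of_rat s * sqrt (of_int D) = of_rat r' + of_rat s' * sqrt (of_int D)"
  shows "r = r' \<and> s = s'"
proof -
  have *: "of_rat (s - s') * sqrt (of_int D) = of_rat (r' - r)"
    using assms(3) by (simp add: of_rat_diff algebra_simps)
  have "s = s'"
  proof (rule ccontr)
    assume "s \<noteq> s'"
    then have "(of_rat (s - s') :: real) \<noteq> 0" by simp
    with * have "sqrt (of_int D) = of_rat ((r' - r) / (s - s'))"
      by (simp add: of_rat_divide field_simps)
    then have "sqrt (of_int D) \<in> \<rat>" by simp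
    with sqrt_squarefree_irrational[OF assms(1,2)] show False by blast
  qed
  with * show ?thesis by simp
qed

lemma quad_int_coords_unique:
  fixes D a b a' b' :: int
  assumes "D \<ge> 2" "squarefree D"
    and "of_int a + of_int b * sqrt (of_int D) = of_int a' + of_int b' * sqrt (of_int D)"
  shows "a = a' \<and> b = b'"
  using quad_coords_unique[OF assms(1,2), of "of_int a" "of_int b" "of_int a'" "of_int b'"] assms(3)
  by simp

lemma quad_field_memI:
  "of_rat r + of_rat s * sqrt (of_int D) \<in> quad_field D"
  by (auto simp: quad_field_def)

lemma half_integer_combination_in_quad_field:
  fixes a b :: int
  shows "(of_int a + of_int b * sqrt (of_int D)) / 2 \<in> quad_field D"
  using quad_field_memI[of "of_int a / 2" "of_int b / 2" D]
  by (simp add: of_rat_divide add_divide_distrib)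

text \<open>
  The description is unique on \<open>quad_field D\<close> because \<open>sqrt D\<close> is irrational
  (\<open>conjugation_eq\<close>); outside this field the value is arbitrary.
\<close>
definition conjugation :: "int \<Rightarrow> real \<Rightarrow> real" where
  "conjugation D x = (THE z. \<exists>r s. x = of_rat r + of_rat s * sqrt (of_int D) \<and>
     z = of_rat r - of_rat s * sqrt (of_int D))"

lemma conjugation_eq:
  assumes "D \<ge> 2" "squarefree D"
  shows "conjugation D (of_rat r + of_rat s * sqrt (of_int D)) = of_rat r - of_rat s * sqrt (of_int D)"
  unfolding conjugation_def
proof (rule the_equality)
  show "\<exists>r' s'. of_rat r + of_rat s * sqrt (of_int D) = of_rat r' + of_rat s' * sqrt (of_int D) \<and>
      of_rat r - of_rat s * sqrt (of_int D) = of_rat r' - of_rat s' * sqrt (of_int D)"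
    by blast
next
  fix z :: real
  assume "\<exists>r' s'. of_rat r + of_rat s * sqrt (of_int D) = of_rat r' + of_rat s' * sqrt (of_int D) \<and>
      z = of_rat r' - of_rat s' * sqrt (of_int D)"
  then show "z = of_rat r - of_rat s * sqrt (of_int D)"
    using quad_coords_unique[OF assms] by blast
qed

lemma real_embedding_conjugation:
  assumes D: "D \<ge> 2" "squarefree D"
  shows "real_embedding (quad_field D) (conjugation D)"
proof -
  let ?w = "sqrt (of_int D)"
  note conj = conjugation_eq[OF D]
  have w: "?w * ?w = of_rat (of_int D)" using D(1) by simp
  have "conjugation D 1 = 1" using conj[of 1 0] by simp
  moreover have "conjugation D (x + y) = conjugation D x + conjugation D y"
    and "conjugation D (x * y) = conjugation D x * conjugation D y"
    if xy: "x \<in> quad_field D" "y \<in> quad_field D" for x y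
  proof -
    obtain r s where x: "x = of_rat r + of_rat s * ?w" using xy(1) by (auto simp: quad_field_def)
    obtain t u where y: "y = of_rat t + of_rat u * ?w" using xy(2) by (auto simp: quad_field_def)
    have "x + y = of_rat (r + t) + of_rat (s + u) * ?w"
      by (simp add: x y of_rat_add algebra_simps)
    then show "conjugation D (x + y) = conjugation D x + conjugation D y"
      by (simp only: conj x y) (simp add: of_rat_add algebra_simps)
    have "x * y = of_rat r * of_rat t + of_rat s * of_rat u * (?w * ?w)
        + (of_rat r * of_rat u + of_rat s * of_rat t) * ?w"
      unfolding x y by (simp only: algebra_simps)
    then have xy: "x * y = of_rat (r * t + s * u * of_int D) + of_rat (r * u + s * t) * ?w"
      by (simp only: w of_rat_add of_rat_mult)
    have "conjugation D x * conjugation D y = of_rat r * of_rat t + of_rat s * of_rat u * (?w * ?w)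
        - (of_rat r * of_rat u + of_rat s * of_rat t) * ?w"
      unfolding x y conj by (simp only: algebra_simps)
    then show "conjugation D (x * y) = conjugation D x * conjugation D y"
      unfolding xy conj by (simp only: w of_rat_add of_rat_mult)
  qed
  moreover have "inj_on (conjugation D) (quad_field D)"
  proof (rule inj_onI)
    fix x y
    assume "x \<in> quad_field D" "y \<in> quad_field D" and eq: "conjugation D x = conjugation D y"
    then obtain r s t u where x: "x = of_rat r + of_rat s * ?w" and y: "y = of_rat t + of_rat u * ?w"
      by (auto simp: quad_field_def)
    have "of_rat r + of_rat (- s) * ?w = of_rat t + of_rat (- u) * ?w"
      using eq by (simp add: x y conj of_rat_minus)
    then have "r = t \<and> - s = - u" by (rule quad_coords_unique[OF D])
    then show "x = y" by (simp add: x y)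
  qed
  ultimately show ?thesis by (simp add: real_embedding_def)
qed

section \<open>The ring of integers\<close>

text \<open>
  Gauss's lemma for quadratic irrationals. Let \<open>q\<close> be the primitive part of the given quadratic and
  \<open>p\<close> a monic integer polynomial with root \<open>x\<close>. Since \<open>x\<close> is irrational, the pseudo-remainder of
  \<open>p\<close> by \<open>q\<close>, which has degree at most 1 and vanishes at \<open>x\<close>, is zero. So \<open>q\<close> divides a constant multiple of
  \<open>p\<close>; as \<open>p\<close> and \<open>q\<close> are primitive, \<open>q\<close> divides \<open>p\<close> itself, and its leading coefficient is a unit.
\<close>
lemma monic_integer_quadratic_of_algebraic_int:
  fixes x :: real and u v w :: int
  assumes "algebraic_int x" "x \<notin> \<rat>" "w \<noteq> 0" "of_int w * x^2 + of_int v * x + of_int u = 0"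
  shows "\<exists>v' u' :: int. x^2 + of_int v' * x + of_int u' = 0"
proof -
  define ev where "ev = (\<lambda>p :: int poly. poly (map_poly real_of_int p) x)"
  have ev_pCons: "ev (pCons c p) = of_int c + x * ev p" for c p
    by (simp add: ev_def map_poly_pCons)
  have ev_0: "ev 0 = 0" by (simp add: ev_def)
  have ev_add: "ev (p + q) = ev p + ev q" for p q
    by (induction p q rule: poly_induct2) (simp_all add: ev_0 ev_pCons algebra_simps)
  have ev_smult: "ev (smult c p) = of_int c * ev p" for c p
    by (induction p) (simp_all add: ev_0 ev_pCons algebra_simps)
  have ev_mult: "ev (p * q) = ev p * ev q" for p q
    by (induction p) (simp_all add: ev_0 ev_pCons ev_add ev_smult algebra_simps)
  obtain p :: "int poly" where p: "ev p = 0" "lead_coeff p = 1"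
    using assms(1) by (auto simp: ev_def algebraic_int_altdef_ipoly)
  define q where "q = primitive_part [:u, v, w:]"
  have q0: "[:u, v, w:] \<noteq> 0" using assms(3) by simp
  have deg_q: "degree q = 2" using assms(3) by (simp add: q_def)
  have content_q: "content q = 1" using q0 by (simp add: q_def content_primitive_part)
  have "ev [:u, v, w:] = 0"
    using assms(4) by (simp add: ev_def map_poly_pCons power2_eq_square algebra_simps)
  moreover have "ev [:u, v, w:] = of_int (content [:u, v, w:]) * ev q"
    unfolding q_def by (metis content_times_primitive_part ev_smult)
  ultimately have "ev q = 0" using q0 by auto
  have "q \<noteq> 0" using deg_q by auto
  obtain h r where hr: "pseudo_divmod p q = (h, r)" by fastforce
  define l where "l = lead_coeff q ^ (Suc (degree p) - degree q)"
  have eq: "smult l p = q * h + r" and r: "r = 0 \<or> degree r < degree q"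
    using pseudo_divmod[OF \<open>q \<noteq> 0\<close> hr] by (auto simp: l_def)
  \<comment> \<open>A nonzero remainder would be constant or linear, which an irrational number cannot satisfy.\<close>
  have "ev r = 0"
    using arg_cong[OF eq, of ev] p \<open>ev q = 0\<close> by (simp add: ev_mult ev_add ev_smult)
  have "r = 0"
  proof (rule ccontr)
    assume "r \<noteq> 0"
    then have "degree r \<le> 1" using r deg_q by simp
    obtain e r1 where e: "r = pCons e r1" by (cases r)
    then have "degree r1 = 0" using \<open>degree r \<le> 1\<close> by (simp split: if_splits)
    then obtain f where ef: "r = [:e, f:]" using e by (auto elim: degree_eq_zeroE)
    have *: "of_int e + x * of_int f = 0" using \<open>ev r = 0\<close> by (simp add: ev_def ef map_poly_pCons)
    have "f \<noteq> 0" using * \<open>r \<noteq> 0\<close> ef by auto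
    then have "x = - of_int e / of_int f" using * by (simp add: field_simps)
    then show False using assms(2) by simp
  qed
  \<comment> \<open>Comparing contents shows that the factor introduced by pseudo-division cancels.\<close>
  have "content p dvd lead_coeff p" by simp
  then have "content p = 1" using p(2) by (metis is_unit_normalize normalize_content)
  then have "content h = normalize l"
    using arg_cong[OF eq, of content] \<open>r = 0\<close> content_q by (simp add: content_mult)
  then have "[:l:] dvd h" by (metis const_poly_dvd_iff_dvd_content dvd_refl normalize_dvd_iff)
  then obtain g where g: "h = smult l g" by (auto simp: dvd_def)
  have "l \<noteq> 0" using \<open>q \<noteq> 0\<close> by (simp add: l_def)
  have "[:l:] * p = [:l:] * (q * g)" using eq \<open>r = 0\<close> g by simp
  then have "p = q * g" using \<open>l \<noteq> 0\<close> by (simp only: mult_cancel_left) simp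
  then have "lead_coeff q * lead_coeff g = 1" using p(2) by (simp add: lead_coeff_mult)
  then have unit: "lead_coeff q * lead_coeff q = 1"
    by (auto simp: zmult_eq_1_iff)
  obtain c0 c1 c2 where c: "q = [:c0, c1, c2:]" "c2 \<noteq> 0"
  proof -
    obtain c0 q1 where "q = pCons c0 q1" by (cases q)
    moreover obtain c1 q2 where "q1 = pCons c1 q2" by (cases q1)
    moreover obtain c2 q3 where "q2 = pCons c2 q3" by (cases q2)
    ultimately have q3: "q = pCons c0 (pCons c1 (pCons c2 q3))" by simp
    then have "degree (pCons c1 (pCons c2 q3)) = 1"
      using deg_q by (simp split: if_splits)
    then have "q3 = 0" "c2 \<noteq> 0" by (auto split: if_splits)
    then show ?thesis using q3 that by simp
  qed
  have "of_int c0 + x * (of_int c1 + x * of_int c2) = 0"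
    using \<open>ev q = 0\<close> by (simp add: ev_def c map_poly_pCons)
  then have "of_int c2 * (of_int c0 + x * (of_int c1 + x * of_int c2)) = 0" by simp
  moreover have "real_of_int c2 * of_int c2 = 1"
    using unit c by (simp flip: of_int_mult)
  moreover have "of_int c2 * (of_int c0 + x * (of_int c1 + x * of_int c2))
      = (of_int c2 * of_int c2) * x^2 + of_int (c2 * c1) * x + of_int (c2 * c0)"
    by (simp add: algebra_simps power2_eq_square)
  ultimately have "x^2 + of_int (c2 * c1) * x + of_int (c2 * c0) = 0" by simp
  then show ?thesis by blast
qed

text \<open>
  In lowest terms the square of the denominator of \<open>t\<close> must divide \<open>D\<close>.
\<close>
lemma rat_integral_if_squarefree_mult_square_integral:
  fixes D n :: int and t :: rat
  assumes "squarefree D" "of_int D * t^2 = of_int n"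
  shows "\<exists>b. t = of_int b"
proof -
  obtain k l where kl: "t = Fract k l" "l > 0" "coprime k l" by (cases t)
  then have t: "t = of_int k / of_int l" by (simp add: Fract_of_int_quotient)
  have "of_int (D * k^2) = (of_int (n * l^2) :: rat)"
    using assms(2) kl(2) by (simp add: t power_divide field_simps)
  then have "D * k^2 = n * l^2" by (simp only: of_int_eq_iff)
  then have "l^2 dvd D * k^2" by simp
  then have "l^2 dvd D" using kl(3) by (simp add: coprime_dvd_mult_left_iff coprime_commute)
  then have "l dvd 1" using assms(1) by (auto simp: squarefree_def)
  then have "l = 1" using kl(2) by simp
  then show ?thesis using t by auto
qed

text \<open>
  The number is a root of \<open>X^2 - a X + (a^2 - D b^2) / 4\<close>. The divisibility condition covers at once
  the two usual shapes of the ring: it means \<open>a\<close> and \<open>b\<close> of equal parity when \<open>D\<close> is 1 modulo 4,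
  and \<open>a\<close> and \<open>b\<close> both even for all other squarefree \<open>D\<close>.
\<close>
lemma ring_of_integers_memI:
  fixes D a b :: int
  assumes "D \<ge> 2" "4 dvd a^2 - D * b^2"
  shows "(of_int a + of_int b * sqrt (of_int D)) / 2 \<in> ring_of_integers (quad_field D)"
proof -
  let ?x = "(of_int a + of_int b * sqrt (of_int D)) / 2"
  obtain n where n: "a^2 - D * b^2 = 4 * n" using assms(2) by (auto simp: dvd_def)
  have nr: "(of_int a :: real)^2 - of_int D * (of_int b)^2 = 4 * of_int n"
    using arg_cong[OF n, of real_of_int] by simp
  have w: "(sqrt (of_int D))^2 = of_int D" using assms(1) by simp
  have "poly (map_poly of_int [:n, - a, 1:]) ?x = 0"
    using nr w by (simp add: map_poly_pCons field_simps power2_eq_square)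
  then have "algebraic_int ?x"
    unfolding algebraic_int_altdef_ipoly by (intro exI[of _ "[:n, - a, 1:]"]) simp
  then show ?thesis
    using half_integer_combination_in_quad_field by (simp add: ring_of_integers_def)
qed

text \<open>
  For \<open>x = r + s sqrt D\<close> with \<open>s \<noteq> 0\<close>, comparing coefficients in a monic integer quadratic
  \<open>x^2 + v x + u = 0\<close> gives \<open>2 r = - v\<close> and \<open>r^2 - D s^2 = u\<close>. Then \<open>D (2 s)^2\<close> is the integer
  \<open>v^2 - 4 u\<close>, and \<open>2 s\<close> is integral because \<open>D\<close> is squarefree.
\<close>
lemma ring_of_integers_memE:
  fixes D :: int
  assumes "D \<ge> 2" "squarefree D" "x \<in> ring_of_integers (quad_field D)"
  obtains a b :: int where "x = (of_int a + of_int b * sqrt (of_int D)) / 2" "4 dvd a^2 - D * b^2"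
proof -
  let ?w = "sqrt (of_int D)"
  obtain r s :: rat where x: "x = of_rat r + of_rat s * ?w" and int: "algebraic_int x"
    using assms(3) by (auto simp: ring_of_integers_def quad_field_def)
  have w: "?w * ?w = of_int D" using assms(1) by simp
  show ?thesis
  proof (cases "s = 0")
    case True
    then have "x \<in> \<rat>" by (simp add: x)
    with int have "x \<in> \<int>" by (rule rational_algebraic_int_is_int)
    then obtain k where "x = of_int k" by (auto simp: Ints_def)
    then show ?thesis using that[of "2 * k" 0] by (simp add: power_mult_distrib)
  next
    case False
    have irr: "x \<notin> \<rat>"
    proof
      assume "x \<in> \<rat>"
      then obtain t where "x = of_rat t" by (auto simp: Rats_def)
      then have "of_rat r + of_rat s * ?w = of_rat t + of_rat 0 * ?w" using x by simp
      with quad_coords_unique[OF assms(1,2)] False show False by blast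
    qed
    obtain k l where kl: "l > 0" "r = of_int k / of_int l"
      by (cases r) (auto simp: Fract_of_int_quotient)
    obtain m n where mn: "n > 0" "s = of_int m / of_int n"
      by (cases s) (auto simp: Fract_of_int_quotient)
    have r: "of_rat r = (of_int k / of_int l :: real)" by (simp add: kl of_rat_divide)
    have s: "of_rat s = (of_int m / of_int n :: real)" by (simp add: mn of_rat_divide)
    have "of_int l * of_int n * x = of_int k * of_int n + of_int l * of_int m * ?w"
      using kl mn by (simp add: x r s field_simps)
    then have "(of_int l * of_int n * x - of_int k * of_int n)^2 = (of_int l * of_int m)^2 * (?w * ?w)"
      by (simp add: power2_eq_square)
    then have "of_int ((l * n)^2) * x^2 + of_int (- 2 * k * l * n^2) * x
        + of_int ((k * n)^2 - D * (l * m)^2) = 0"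
      unfolding w by (simp add: power2_eq_square algebra_simps)
    moreover have "(l * n)^2 \<noteq> 0" using kl mn by simp
    ultimately obtain v u :: int where vu: "x^2 + of_int v * x + of_int u = 0"
      using monic_integer_quadratic_of_algebraic_int[OF int irr] by blast
    have "x^2 + of_int v * x + of_int u = of_rat r * of_rat r + of_rat s * of_rat s * (?w * ?w)
        + of_int v * of_rat r + of_int u + (2 * of_rat r * of_rat s + of_int v * of_rat s) * ?w"
      by (simp add: x power2_eq_square algebra_simps)
    then have "of_rat (r * r + s * s * of_int D + of_int v * r + of_int u)
        + of_rat (2 * r * s + of_int v * s) * ?w = of_rat 0 + of_rat 0 * ?w"
      using vu unfolding w by (simp add: of_rat_add of_rat_mult)
    then have e: "r * r + s * s * of_int D + of_int v * r + of_int u = 0" "2 * r * s + of_int v * s = 0"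
      using quad_coords_unique[OF assms(1,2)] by blast+
    have "s * (2 * r + of_int v) = 0" using e(2) by (simp add: algebra_simps)
    with False have rv: "2 * r = - of_int v" by (simp add: add_eq_0_iff2)
    have "of_int D * (2 * s)^2 = (2 * r)^2 - 4 * (r * r - s * s * of_int D)"
      by (simp add: power2_eq_square algebra_simps)
    also have "r * r - s * s * of_int D = of_int u"
      using e(1) rv by algebra
    also have "(2 * r)^2 - 4 * of_int u = of_int (v^2 - 4 * u)"
      unfolding rv by simp
    finally have Ds: "of_int D * (2 * s)^2 = of_int (v^2 - 4 * u)" .
    then obtain b where b: "2 * s = of_int b"
      using rat_integral_if_squarefree_mult_square_integral[OF assms(2)] by blast
    have "of_int (D * b^2) = (of_int (v^2 - 4 * u) :: rat)"
      using Ds unfolding b by simp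
    then have "D * b^2 = v^2 - 4 * u" by (simp only: of_int_eq_iff)
    then have "4 dvd (- v)^2 - D * b^2" by simp
    moreover have "x = (of_int (- v) + of_int b * ?w) / 2"
    proof -
      have "2 * of_rat r = (of_int (- v) :: real)"
        using arg_cong[OF rv, of "of_rat :: rat \<Rightarrow> real"] by (simp add: of_rat_mult of_rat_minus)
      moreover have "2 * of_rat s = (of_int b :: real)"
        using arg_cong[OF b, of "of_rat :: rat \<Rightarrow> real"] by (simp add: of_rat_mult)
      ultimately show ?thesis unfolding x
        by (simp add: field_simps)
    qed
    ultimately show ?thesis using that by blast
  qed
qed

text \<open>
  The product of \<open>(a + b w) / 2\<close> and \<open>(c + d w) / 2\<close> is \<open>(e + f w) / 2\<close>. The halves are integral
  because \<open>a\<close> has the parity of \<open>D b\<close> and \<open>c\<close> that of \<open>D d\<close>; the rest is multiplicativity of the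
  norm.
\<close>
lemma half_coords_mult:
  fixes D a b c d :: int
  assumes "4 dvd a^2 - D * b^2" "4 dvd c^2 - D * d^2"
  obtains e f where "a * c + D * b * d = 2 * e" "a * d + b * c = 2 * f" "4 dvd e^2 - D * f^2"
    "4 * (e^2 - D * f^2) = (a^2 - D * b^2) * (c^2 - D * d^2)"
proof -
  have "even (a^2 - D * b^2)" "even (c^2 - D * d^2)"
    using assms by (auto elim: dvd_trans[rotated] simp del: even_diff)
  then have "even a \<longleftrightarrow> even (D * b)" "even c \<longleftrightarrow> even (D * d)" by auto
  then have "even (a * c + D * b * d)" "even (a * d + b * c)" by auto
  then obtain e f where ef: "a * c + D * b * d = 2 * e" "a * d + b * c = 2 * f"
    by (metis evenE)
  have "4 * (e^2 - D * f^2) = (2 * e)^2 - D * (2 * f)^2" by (simp add: power_mult_distrib algebra_simps)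
  also have "\<dots> = (a^2 - D * b^2) * (c^2 - D * d^2)"
    unfolding ef[symmetric] by algebra
  finally have norm: "4 * (e^2 - D * f^2) = (a^2 - D * b^2) * (c^2 - D * d^2)" .
  have "4 * 4 dvd (a^2 - D * b^2) * (c^2 - D * d^2)" using assms by (rule mult_dvd_mono)
  then have "4 dvd e^2 - D * f^2" unfolding norm[symmetric] by (metis dvd_mult_cancel_left zero_neq_numeral)
  then show ?thesis using that ef norm by blast
qed

lemma ring_of_integers_mult:
  assumes "D \<ge> 2" "squarefree D"
    and "x \<in> ring_of_integers (quad_field D)" "y \<in> ring_of_integers (quad_field D)"
  shows "x * y \<in> ring_of_integers (quad_field D)"
proof -
  let ?w = "sqrt (of_int D)"
  obtain a b where ab: "x = (of_int a + of_int b * ?w) / 2" "4 dvd a^2 - D * b^2"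
    using ring_of_integers_memE[OF assms(1-3)] .
  obtain c d where cd: "y = (of_int c + of_int d * ?w) / 2" "4 dvd c^2 - D * d^2"
    using ring_of_integers_memE[OF assms(1,2,4)] .
  obtain e f where ef: "a * c + D * b * d = 2 * e" "a * d + b * c = 2 * f" "4 dvd e^2 - D * f^2"
    using half_coords_mult[OF ab(2) cd(2)] by blast
  have w: "?w * ?w = of_int D" using assms(1) by simp
  have "x * y = (of_int a * of_int c + of_int b * of_int d * (?w * ?w)
      + (of_int a * of_int d + of_int b * of_int c) * ?w) / 4"
    by (simp add: ab cd field_simps)
  also have "\<dots> = (of_int (a * c + D * b * d) + of_int (a * d + b * c) * ?w) / 4"
    unfolding w by (simp add: algebra_simps)
  also have "\<dots> = (of_int e + of_int f * ?w) / 2" unfolding ef by simp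
  finally show ?thesis using ring_of_integers_memI[OF assms(1) ef(3)] by (simp only:)
qed

section \<open>Total positivity\<close>

lemma real_embedding_of_nat:
  assumes emb: "real_embedding (quad_field D) \<sigma>"
  shows "\<sigma> (of_nat n) = of_nat n"
proof -
  have nat: "of_nat n \<in> quad_field D" for n
    using quad_field_memI[of "of_nat n" 0 D] by simp
  have add: "\<sigma> (of_nat m + of_nat n) = \<sigma> (of_nat m) + \<sigma> (of_nat n)" for m n
    using emb nat by (simp add: real_embedding_def)
  show ?thesis
  proof (induction n)
    case 0
    show ?case using add[of 0 0] by simp
  next
    case (Suc n)
    then show ?case using add[of n 1] emb by (simp add: real_embedding_def add.commute)
  qed
qed

lemma less_sqrt_mult_iff:
  fixes D a b :: int
  assumes "D \<ge> 2"
  shows "0 < of_int a - \<bar>of_int b\<bar> * sqrt (of_int D) \<longleftrightarrow> 0 < a \<and> D * b^2 < a^2"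
proof -
  have "\<bar>of_int b\<bar> * sqrt (of_int D) = sqrt (of_int (D * b^2))"
    by (simp add: real_sqrt_mult)
  moreover have "sqrt (of_int (D * b^2)) < of_int a \<longleftrightarrow> 0 < a \<and> D * b^2 < a^2"
  proof (cases "a > 0")
    case True
    then have "sqrt (of_int (D * b^2)) < of_int a \<longleftrightarrow> of_int (D * b^2) < (of_int a :: real)^2"
      by (metis of_int_0_le_iff order_less_imp_le real_less_lsqrt real_sqrt_abs real_sqrt_less_iff abs_of_nonneg)
    also have "\<dots> \<longleftrightarrow> D * b^2 < a^2" by (metis of_int_less_iff of_int_power)
    finally show ?thesis using True by simp
  next
    case False
    moreover have "0 \<le> sqrt (of_int (D * b^2))" using assms by simp
    ultimately show ?thesis by (smt (verit) of_int_0_less_iff)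
  qed
  ultimately show ?thesis by simp
qed

text \<open>
  The identity and conjugation give the necessary inequalities. Conversely, the trace \<open>a\<close> and the
  norm \<open>n\<close> of \<open>x\<close> are positive integers, hence fixed by every embedding \<open>\<sigma>\<close>; applying \<open>\<sigma>\<close> to
  \<open>x^2 + n = a x\<close> shows \<open>a (\<sigma> x) > 0\<close>. This avoids a classification of the embeddings.
\<close>
lemma totally_positive_iff:
  fixes D a b :: int
  assumes D: "D \<ge> 2" "squarefree D" and ab: "4 dvd a^2 - D * b^2"
  shows "totally_positive (quad_field D) ((of_int a + of_int b * sqrt (of_int D)) / 2)
    \<longleftrightarrow> 0 < a \<and> D * b^2 < a^2"
proof
  let ?w = "sqrt (of_int D)" and ?K = "quad_field D"
  let ?x = "(of_int a + of_int b * ?w) / 2"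
  assume tp: "totally_positive ?K ?x"
  have "real_embedding ?K id" by (simp add: real_embedding_def)
  with tp have "0 < id ?x" unfolding totally_positive_def by blast
  moreover have "0 < conjugation D ?x"
    using tp real_embedding_conjugation[OF D] unfolding totally_positive_def by blast
  moreover have "conjugation D ?x = (of_int a - of_int b * ?w) / 2"
    using conjugation_eq[OF D, of "of_int a / 2" "of_int b / 2"]
    by (simp add: of_rat_divide add_divide_distrib diff_divide_distrib)
  ultimately have "0 < of_int a - \<bar>of_int b\<bar> * ?w" by (simp add: abs_if)
  then show "0 < a \<and> D * b^2 < a^2" using less_sqrt_mult_iff[OF D(1)] by blast
next
  let ?w = "sqrt (of_int D)" and ?K = "quad_field D"
  let ?x = "(of_int a + of_int b * ?w) / 2"
  assume pos: "0 < a \<and> D * b^2 < a^2"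
  obtain n where n: "a^2 - D * b^2 = 4 * n" using ab by (auto simp: dvd_def)
  have "n > 0" using n pos by simp
  have nr: "(of_int a :: real)^2 - of_int D * (of_int b)^2 = 4 * of_int n"
    using arg_cong[OF n, of real_of_int] by simp
  have w: "?w^2 = of_int D" using D(1) by simp
  have eq: "?x * ?x + of_nat (nat n) = of_nat (nat a) * ?x"
    using \<open>n > 0\<close> pos nr w by (simp add: field_simps power2_eq_square)
  have K: "?x \<in> ?K" "?x * ?x \<in> ?K" "of_nat (nat n) \<in> ?K" "of_nat (nat a) \<in> ?K"
  proof -
    show "?x \<in> ?K" by (rule half_integer_combination_in_quad_field)
    have "?x \<in> ring_of_integers ?K" by (rule ring_of_integers_memI[OF D(1) ab])
    then show "?x * ?x \<in> ?K"
      using ring_of_integers_mult[OF D] unfolding ring_of_integers_def by blast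
    show "of_nat (nat n) \<in> ?K" "of_nat (nat a) \<in> ?K"
      using quad_field_memI[of "of_nat (nat n)" 0 D] quad_field_memI[of "of_nat (nat a)" 0 D] by auto
  qed
  show "totally_positive ?K ?x"
    unfolding totally_positive_def
  proof (intro allI impI)
    fix \<sigma> assume emb: "real_embedding ?K \<sigma>"
    have "\<sigma> (?x * ?x) + \<sigma> (of_nat (nat n)) = \<sigma> (of_nat (nat a)) * \<sigma> ?x"
      using arg_cong[OF eq, of \<sigma>] emb K unfolding real_embedding_def by metis
    moreover have "\<sigma> (?x * ?x) = \<sigma> ?x * \<sigma> ?x" using emb K unfolding real_embedding_def by blast
    ultimately have "\<sigma> ?x * \<sigma> ?x + of_nat (nat n) = of_nat (nat a) * \<sigma> ?x"
      by (simp add: real_embedding_of_nat[OF emb])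
    moreover have "0 < \<sigma> ?x * \<sigma> ?x + of_nat (nat n)"
      using \<open>n > 0\<close> by (intro add_nonneg_pos) auto
    ultimately show "0 < \<sigma> ?x" using pos by (simp add: zero_less_mult_iff)
  qed
qed

section \<open>Sums of squares\<close>

lemma sum_of_squares_add:
  assumes "sum_of_squares R x" "sum_of_squares R y"
  shows "sum_of_squares R (x + y)"
proof -
  obtain xs ys where "set xs \<subseteq> R" "x = sum_list (map (\<lambda>y. y^2) xs)"
    "set ys \<subseteq> R" "y = sum_list (map (\<lambda>y. y^2) ys)"
    using assms by (auto simp: sum_of_squares_def)
  then show ?thesis unfolding sum_of_squares_def by (intro exI[of _ "xs @ ys"]) simp
qed

lemma sum_of_squares_square: "x \<in> R \<Longrightarrow> sum_of_squares R (x^2)"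
  unfolding sum_of_squares_def by (intro exI[of _ "[x]"]) simp

lemma sum_of_squares_of_nat_mult:
  assumes "sum_of_squares R x"
  shows "sum_of_squares R (of_nat n * x)"
proof (induction n)
  case 0
  show ?case unfolding sum_of_squares_def by (intro exI[of _ "[]"]) simp
next
  case (Suc n)
  then show ?case using sum_of_squares_add[OF assms Suc.IH] by (simp add: algebra_simps)
qed

lemma sum_of_squares_square_mult:
  assumes "sum_of_squares R x" "u \<in> R" "\<And>v. v \<in> R \<Longrightarrow> u * v \<in> R"
  shows "sum_of_squares R (u^2 * x)"
proof -
  obtain xs where "set xs \<subseteq> R" "x = sum_list (map (\<lambda>y. y^2) xs)"
    using assms(1) by (auto simp: sum_of_squares_def)
  then show ?thesis using assms(3) unfolding sum_of_squares_def
    by (intro exI[of _ "map ((*) u) xs"])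
      (auto simp: o_def power_mult_distrib sum_list_const_mult)
qed

text \<open>
  The pairs are the doubled coordinates of the summands' square roots, so the two equations compare
  four times the rational and the irrational parts.
\<close>
lemma sum_of_squares_coords:
  fixes D a b :: int
  assumes D: "D \<ge> 2" "squarefree D"
    and "sum_of_squares (ring_of_integers (quad_field D)) (of_int a + of_int b * sqrt (of_int D))"
  obtains ps :: "(int \<times> int) list" where
    "\<And>x y. (x, y) \<in> set ps \<Longrightarrow> 4 dvd x^2 - D * y^2"
    "4 * a = (\<Sum>(x, y)\<leftarrow>ps. x^2) + D * (\<Sum>(x, y)\<leftarrow>ps. y^2)"
    "2 * b = (\<Sum>(x, y)\<leftarrow>ps. x * y)"
proof -
  let ?w = "sqrt (of_int D)"
  have w: "?w^2 = of_int D" using D(1) by simp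
  have *: "\<exists>ps :: (int \<times> int) list. (\<forall>(x, y) \<in> set ps. 4 dvd x^2 - D * y^2) \<and>
      4 * sum_list (map (\<lambda>y. y^2) zs) = of_int ((\<Sum>(x, y)\<leftarrow>ps. x^2) + D * (\<Sum>(x, y)\<leftarrow>ps. y^2))
        + of_int (2 * (\<Sum>(x, y)\<leftarrow>ps. x * y)) * ?w"
    if "set zs \<subseteq> ring_of_integers (quad_field D)" for zs
    using that
  proof (induction zs)
    case Nil
    show ?case by (intro exI[of _ "[]"]) simp
  next
    case (Cons z zs)
    then obtain ps :: "(int \<times> int) list" where ps: "\<forall>(x, y) \<in> set ps. 4 dvd x^2 - D * y^2"
      "4 * sum_list (map (\<lambda>y. y^2) zs) = of_int ((\<Sum>(x, y)\<leftarrow>ps. x^2) + D * (\<Sum>(x, y)\<leftarrow>ps. y^2))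
        + of_int (2 * (\<Sum>(x, y)\<leftarrow>ps. x * y)) * ?w"
      by auto
    have "z \<in> ring_of_integers (quad_field D)" using Cons.prems by simp
    then obtain x y where z: "z = (of_int x + of_int y * ?w) / 2" "4 dvd x^2 - D * y^2"
      by (rule ring_of_integers_memE[OF D])
    have "4 * z^2 = of_int (x^2) + ?w^2 * of_int (y^2) + of_int (2 * x * y) * ?w"
      unfolding z by (simp add: power2_eq_square algebra_simps)
    then have "4 * z^2 = of_int (x^2) + of_int D * of_int (y^2) + of_int (2 * x * y) * ?w"
      unfolding w .
    then show ?case using ps z(2)
      by (intro exI[of _ "(x, y) # ps"]) (simp add: algebra_simps)
  qed
  obtain zs where zs: "set zs \<subseteq> ring_of_integers (quad_field D)"
    "of_int a + of_int b * ?w = sum_list (map (\<lambda>y. y^2) zs)"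
    using assms(3) by (auto simp: sum_of_squares_def)
  obtain ps :: "(int \<times> int) list" where ps: "\<forall>(x, y) \<in> set ps. 4 dvd x^2 - D * y^2"
    and eq: "4 * (of_int a + of_int b * ?w) = of_int ((\<Sum>(x, y)\<leftarrow>ps. x^2) + D * (\<Sum>(x, y)\<leftarrow>ps. y^2))
        + of_int (2 * (\<Sum>(x, y)\<leftarrow>ps. x * y)) * ?w"
    using *[OF zs(1)] zs(2) by metis
  have "of_int (4 * a) + of_int (4 * b) * ?w
      = of_int ((\<Sum>(x, y)\<leftarrow>ps. x^2) + D * (\<Sum>(x, y)\<leftarrow>ps. y^2))
        + of_int (2 * (\<Sum>(x, y)\<leftarrow>ps. x * y)) * ?w"
    using eq by (simp add: algebra_simps)
  from quad_int_coords_unique[OF D this] ps show ?thesis by (intro that[of ps]) auto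
qed

section \<open>Small totally positive elements\<close>

text \<open>
  Squares are 0 or 1 modulo 4, and \<open>D\<close> is 2 or 3 modulo 4.
\<close>
lemma even_coords:
  fixes D x y :: int
  assumes "squarefree D" "D mod 4 \<noteq> 1" "4 dvd x^2 - D * y^2"
  shows "even x \<and> even y"
proof -
  have "\<not> 2^2 dvd D" using squarefreeD[OF assms(1), of 2] by auto
  then have D: "D mod 4 = 2 \<or> D mod 4 = 3" using assms(2) by simp presburger
  have sq: "z^2 mod 4 = (if even z then 0 else 1)" for z :: int
  proof (cases "even z")
    case True
    then show ?thesis by (auto elim!: evenE simp: power_mult_distrib)
  next
    case False
    then obtain k where "z = 2 * k + 1" by (auto elim: oddE)
    then have "z^2 = 4 * (k^2 + k) + 1" by (simp add: power2_eq_square algebra_simps)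
    then show ?thesis using False by presburger
  qed
  have "x^2 mod 4 = (D * y^2) mod 4" using assms(3) by (simp add: mod_eq_dvd_iff)
  also have "\<dots> = ((D mod 4) * (y^2 mod 4)) mod 4" by (simp add: mod_mult_eq)
  finally show ?thesis using D unfolding sq by (auto split: if_splits)
qed

lemma sum_list_mult_nonzeroE:
  fixes ps :: "(int \<times> int) list"
  assumes "(\<Sum>(x, y)\<leftarrow>ps. x * y) \<noteq> 0"
  obtains x y where "(x, y) \<in> set ps" "x \<noteq> 0" "y \<noteq> 0"
    "x^2 \<le> (\<Sum>(x, y)\<leftarrow>ps. x^2)" "y^2 \<le> (\<Sum>(x, y)\<leftarrow>ps. y^2)"
proof -
  have "\<exists>(x, y) \<in> set ps. x * y \<noteq> 0"
  proof (rule ccontr)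
    assume "\<not> ?thesis"
    then have "map (\<lambda>(x, y). x * y) ps = map (\<lambda>_. 0) ps" by (intro map_cong) auto
    then show False using assms by (metis sum_list_0)
  qed
  then obtain x y where xy: "(x, y) \<in> set ps" "x * y \<noteq> 0" by blast
  have "(case (x, y) of (x, y) \<Rightarrow> x^2) \<le> (\<Sum>(x, y)\<leftarrow>ps. x^2)"
    "(case (x, y) of (x, y) \<Rightarrow> y^2) \<le> (\<Sum>(x, y)\<leftarrow>ps. y^2)"
    using xy(1) by (auto intro!: member_le_sum_list)
  then show ?thesis using that xy by auto
qed

lemma int_sqrt_bracket:
  fixes D :: int
  assumes "D \<ge> 2" "squarefree D"
  obtains s where "s \<ge> 1" "s^2 < D" "D < (s + 1)^2"
proof -
  define s where "s = \<lfloor>sqrt (of_int D)\<rfloor>"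
  have s: "of_int s \<le> sqrt (of_int D)" "sqrt (of_int D) < of_int (s + 1)"
    unfolding s_def by (auto simp: floor_correct) 
  have "s \<ge> 1" unfolding s_def using assms(1) by simp
  have "(of_int s)^2 \<le> (sqrt (of_int D))^2" using s(1) \<open>s \<ge> 1\<close> by (intro power_mono) auto
  then have "of_int (s^2) \<le> (of_int D :: real)" using assms(1) by simp
  then have "s^2 \<le> D" by (simp only: of_int_le_iff)
  moreover have "(sqrt (of_int D))^2 < (of_int (s + 1))^2" using s(2) assms(1) by (intro power_strict_mono) auto
  then have "of_int D < (of_int ((s + 1)^2) :: real)" using assms(1) by simp
  then have "D < (s + 1)^2" by (simp only: of_int_less_iff)
  ultimately show ?thesis using that[OF \<open>s \<ge> 1\<close>] squarefree_nonsquare[OF assms, of s] by simp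
qed

text \<open>
  The test element is the one with the smallest trace among those with the smallest positive \<open>b\<close>.
  If \<open>D\<close> is 1 modulo 4, then \<open>b = 1\<close> and \<open>a\<close> is the least odd number above \<open>sqrt D\<close>. The sum of
  the \<open>x y\<close> is 2, and \<open>y^2\<close> has the parity of \<open>x y\<close>, so the sum of the \<open>y^2\<close> is even and thus at
  least 2; hence \<open>4 a > 2 D\<close>. Otherwise \<open>b = 2\<close> and \<open>a = 2 (s + 1)\<close> with \<open>s\<close> the integer part of
  \<open>sqrt D\<close>, all \<open>x\<close> and \<open>y\<close> are even, and \<open>8 (s + 1) \<ge> 4 + 4 D\<close>.
\<close>
lemma doubles_sums_of_squares_imp:
  fixes D :: int
  assumes D: "D \<ge> 2" "squarefree D"
    and sos: "\<And>a b. 4 dvd a^2 - D * b^2 \<Longrightarrow> 0 < a \<Longrightarrow> D * b^2 < a^2 \<Longrightarrow>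
      sum_of_squares (ring_of_integers (quad_field D)) (of_int a + of_int b * sqrt (of_int D))"
  shows "D = 2 \<or> D = 3 \<or> D = 5"
proof -
  obtain s where s: "s \<ge> 1" "s^2 < D" "D < (s + 1)^2" by (rule int_sqrt_bracket[OF D])
  show ?thesis
  proof (cases "D mod 4 = 1")
    case True
    define a where "a = (if odd s then s + 2 else s + 1)"
    have a: "odd a" "a \<ge> 2" "a - 2 \<le> s" "s + 1 \<le> a" using s(1) by (auto simp: a_def)
    have "(s + 1)^2 \<le> a^2" using a s by (intro power_mono) auto
    then have "D * 1^2 < a^2" using s by simp
    moreover have "4 dvd a^2 - D * 1^2"
    proof -
      obtain k where "a = 2 * k + 1" using a(1) by (auto elim: oddE)
      then have "a^2 = 4 * (k^2 + k) + 1" by (simp add: power2_eq_square algebra_simps)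
      moreover obtain j where "D = 4 * j + 1" using True by (metis mult_div_mod_eq)
      ultimately show ?thesis by simp
    qed
    ultimately obtain ps :: "(int \<times> int) list" where ps:
      "\<And>x y. (x, y) \<in> set ps \<Longrightarrow> 4 dvd x^2 - D * y^2"
      "4 * a = (\<Sum>(x, y)\<leftarrow>ps. x^2) + D * (\<Sum>(x, y)\<leftarrow>ps. y^2)"
      "2 * 1 = (\<Sum>(x, y)\<leftarrow>ps. x * y)"
      using sum_of_squares_coords[OF D sos[of a 1]] a(2) by (smt (verit))
    have "(\<Sum>(x, y)\<leftarrow>ps. x * y) \<noteq> 0" using ps(3) by simp
    then obtain x y where xy: "x \<noteq> 0" "y \<noteq> 0" 
      "x^2 \<le> (\<Sum>(x, y)\<leftarrow>ps. x^2)" "y^2 \<le> (\<Sum>(x, y)\<leftarrow>ps. y^2)"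
      by (rule sum_list_mult_nonzeroE)
    have parity: "even (\<Sum>(x, y)\<leftarrow>qs. y^2) \<longleftrightarrow> even (\<Sum>(x, y)\<leftarrow>qs. x * y)"
      if "set qs \<subseteq> set ps" for qs
      using that
    proof (induction qs)
      case (Cons q qs)
      obtain u v where q: "q = (u, v)" by (cases q)
      then have "4 dvd u^2 - D * v^2" using ps(1) Cons.prems by auto
      then have "even (u^2 - D * v^2)" by (rule dvd_trans[rotated]) simp
      moreover have "odd D" using True by presburger
      ultimately have "even u \<longleftrightarrow> even v" by auto
      then show ?case using Cons q by auto
    qed simp
    have "even (\<Sum>(x, y)\<leftarrow>ps. y^2)" using parity[of ps] ps(3)[symmetric] by simp
    moreover have "0 < x^2" "0 < y^2" using xy by auto
    ultimately have "1 \<le> (\<Sum>(x, y)\<leftarrow>ps. x^2)" "2 \<le> (\<Sum>(x, y)\<leftarrow>ps. y^2)" using xy(3,4) by (smt (verit) even_plus_one_iff odd_one)+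
    then have "D * 2 \<le> D * (\<Sum>(x, y)\<leftarrow>ps. y^2)" "1 \<le> (\<Sum>(x, y)\<leftarrow>ps. x^2)"
      using D(1) by (auto intro: mult_left_mono)
    then have "D < 2 * a" using ps(2) by simp
    have "(a - 2)^2 \<le> s^2" using a s by (intro power_mono) auto
    then have lower: "(a - 2)^2 < D" using s by simp
    have "a \<le> 5"
    proof (rule ccontr)
      assume "\<not> a \<le> 5"
      then have "4 * (a - 2) \<le> (a - 2)^2" unfolding power2_eq_square by (intro mult_right_mono) auto
      then have "4 * (a - 2) < D" using lower by (rule order_le_less_trans)
      then show False using \<open>D < 2 * a\<close> \<open>\<not> a \<le> 5\<close> by simp
    qed
    then have "a \<in> {2, 3, 4, 5}" using a by auto
    then consider "a = 3" | "a = 5" using a(1) by auto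
    then show ?thesis
    proof cases
      case 1
      then show ?thesis using \<open>D < 2 * a\<close> True D(1) by presburger
    next
      case 2
      then show ?thesis using \<open>D < 2 * a\<close> lower by simp
    qed
  next
    case False
    have "D * 2^2 < (2 * (s + 1))^2" using s(3) power_mult_distrib[of 2 "s + 1" 2] by simp
    moreover have "(2 * (s + 1))^2 - D * 2^2 = 4 * ((s + 1)^2 - D)"
      by (simp add: power2_eq_square algebra_simps)
    then have "4 dvd (2 * (s + 1))^2 - D * 2^2" by (simp only: dvd_triv_left)
    ultimately obtain ps :: "(int \<times> int) list" where ps:
      "\<And>x y. (x, y) \<in> set ps \<Longrightarrow> 4 dvd x^2 - D * y^2"
      "4 * (2 * (s + 1)) = (\<Sum>(x, y)\<leftarrow>ps. x^2) + D * (\<Sum>(x, y)\<leftarrow>ps. y^2)"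
      "2 * 2 = (\<Sum>(x, y)\<leftarrow>ps. x * y)"
      using sum_of_squares_coords[OF D sos[of "2 * (s + 1)" 2]] s(1) by (smt (verit))
    have "(\<Sum>(x, y)\<leftarrow>ps. x * y) \<noteq> 0" using ps(3) by simp
    then obtain x y where xy: "(x, y) \<in> set ps" "x \<noteq> 0" "y \<noteq> 0"
      "x^2 \<le> (\<Sum>(x, y)\<leftarrow>ps. x^2)" "y^2 \<le> (\<Sum>(x, y)\<leftarrow>ps. y^2)"
      by (rule sum_list_mult_nonzeroE)
    have four: "4 \<le> z^2" if "even z" "z \<noteq> 0" for z :: int
    proof -
      have "2 \<le> \<bar>z\<bar>" using that by presburger
      then have "2^2 \<le> \<bar>z\<bar>^2" by (intro power_mono) auto
      then show ?thesis by simp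
    qed
    have "even x \<and> even y"
      by (rule even_coords[OF D(2) False ps(1)[OF xy(1)]])
    then have "4 \<le> x^2" "4 \<le> y^2" using four xy by auto
    then have "D * 4 \<le> D * (\<Sum>(x, y)\<leftarrow>ps. y^2)" "4 \<le> (\<Sum>(x, y)\<leftarrow>ps. x^2)"
      using D(1) xy by (auto intro: mult_left_mono)
    then have "D \<le> 2 * s + 1" using ps(2) by simp
    have "s \<le> 2"
    proof (rule ccontr)
      assume "\<not> s \<le> 2"
      then have "3 * s \<le> s^2" unfolding power2_eq_square by (intro mult_right_mono) auto
      then show False using s(2) \<open>D \<le> 2 * s + 1\<close> \<open>\<not> s \<le> 2\<close> by linarith
    qed
    \<comment> \<open>\<open>s = 1\<close> allows 2 and 3, while \<open>s = 2\<close> leaves \<open>4 < D \<le> 5\<close>.\<close>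
    then consider "s = 1" | "s = 2" using s(1) by linarith
    then show ?thesis
      using \<open>D \<le> 2 * s + 1\<close> s(2) D(1) by cases auto
  qed
qed

section \<open>Descent by squares of units\<close>

text \<open>
  Let \<open>\<epsilon> = (p + q w) / 2\<close>, a unit of norm 1 that, like its conjugate, is a square in the ring.
  Dividing \<open>a + b w\<close> by \<open>\<epsilon>\<close> replaces \<open>a\<close> by \<open>(p a - D q b) / 2\<close> and preserves the norm. For
  \<open>b \<ge> 0\<close> this is smaller than \<open>a\<close> exactly when \<open>(p - 2) a < D q b\<close>, that is, when \<open>a < c b\<close>; this
  is where the relation between \<open>c\<close> and \<open>p, q\<close> comes from. Induction on \<open>a\<close> therefore reduces to
  \<open>a \<ge> c b\<close>, where \<open>a + b w = (b / k) (k (c + w)) + (a - c b)\<close>. The claim is made for \<open>b\<close> and \<open>- b\<close>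
  together so that \<open>b \<ge> 0\<close> may be assumed although the descent can change the sign of \<open>b\<close>.
\<close>
lemma unit_square_descent:
  fixes D p q c k a b :: int and u u' :: real
  defines "R \<equiv> ring_of_integers (quad_field D)" and "w \<equiv> sqrt (of_int D)"
  assumes D: "D \<ge> 2" "squarefree D"
    and pq: "p^2 - D * q^2 = 4" "p > 2" "q > 0"
    and u: "u \<in> R" "u^2 = (of_int p + of_int q * w) / 2"
    and u': "u' \<in> R" "u'^2 = (of_int p - of_int q * w) / 2"
    and c: "D * q = (p - 2) * c"
    and k: "k > 0" "\<And>a b. 4 dvd a^2 - D * b^2 \<Longrightarrow> k dvd b"
    and extreme: "sum_of_squares R (of_int k * (of_int c + w))" "sum_of_squares R (of_int k * (of_int c - w))"
    and ab: "4 dvd a^2 - D * b^2" "0 < a" "D * b^2 < a^2"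
  shows "sum_of_squares R (of_int a + of_int b * w) \<and> sum_of_squares R (of_int a - of_int b * w)"
  using ab
proof (induction "nat a" arbitrary: a b rule: less_induct)
  case less
  let ?P = "\<lambda>a b :: int. sum_of_squares R (of_int a + of_int b * w) \<and> sum_of_squares R (of_int a - of_int b * w)"
  have one: "sum_of_squares R 1"
    using sum_of_squares_square[of 1 R] ring_of_integers_memI[OF D(1), of 2 0] by (simp add: R_def)
  have nonneg: "?P a b" if ab: "4 dvd a^2 - D * b^2" "D * b^2 < a^2" and "b \<ge> 0" for b
  proof (cases "c * b \<le> a")
    case True
    obtain j where j: "b = k * j" using k(2)[OF ab(1)] by (auto simp: dvd_def)
    have "j \<ge> 0" using j \<open>b \<ge> 0\<close> k(1) by (simp add: zero_le_mult_iff)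
    define i where "i = a - c * b"
    have "i \<ge> 0" using True by (simp add: i_def)
    have "of_int a + of_int b * w = of_nat (nat j) * (of_int k * (of_int c + w)) + of_nat (nat i) * 1"
      "of_int a - of_int b * w = of_nat (nat j) * (of_int k * (of_int c - w)) + of_nat (nat i) * 1"
      using \<open>j \<ge> 0\<close> \<open>i \<ge> 0\<close> by (simp_all add: i_def j algebra_simps)
    then show ?thesis
      by (auto intro!: sum_of_squares_add sum_of_squares_of_nat_mult extreme one simp del: mult_1_right)
  next
    case False
    \<comment> \<open>\<open>a' + b' w\<close> is \<open>a + b w\<close> times the conjugate of \<open>\<epsilon>\<close>, which is its inverse.\<close>
    have "4 dvd p^2 - D * (- q)^2" using pq(1) by simp
    then obtain a' b' where a'b': "a * p + D * b * (- q) = 2 * a'" "a * (- q) + b * p = 2 * b'"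
      "4 dvd a'^2 - D * b'^2" "4 * (a'^2 - D * b'^2) = (a^2 - D * b^2) * (p^2 - D * (- q)^2)"
      using half_coords_mult[OF ab(1), of p "- q"] by blast
    have norm: "a'^2 - D * b'^2 = a^2 - D * b^2" using a'b'(4) pq(1) by simp
    have "a' < a"
    proof -
      have "(p - 2) * a < (p - 2) * (c * b)" using False pq(2) by simp
      also have "\<dots> = D * q * b" using c by simp
      finally show ?thesis using a'b'(1) by (simp add: algebra_simps)
    qed
    moreover have "a' > 0"
    proof -
      have "(D * q * b)^2 = (D * q^2) * (D * b^2)" by (simp add: power2_eq_square algebra_simps)
      also have "\<dots> \<le> (D * q^2) * a^2" using ab(2) D(1) by (intro mult_left_mono) auto
      also have "\<dots> < p^2 * a^2"
        using pq(1) less.prems(2) by (intro mult_strict_right_mono) auto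
      finally have "(D * q * b)^2 < (p * a)^2" by (simp add: power_mult_distrib)
      then have "D * q * b < p * a"
        using pq(2) less.prems(2) by (auto intro: power_less_imp_less_base[of _ 2])
      then show ?thesis using a'b'(1) by (simp add: algebra_simps)
    qed
    ultimately have IH: "?P a' b'"
      using less.hyps[of a' b'] a'b'(3) norm ab(2) by simp
    have mult: "sum_of_squares R (v^2 * x)" if "v \<in> R" "sum_of_squares R x" for v x
      using sum_of_squares_square_mult[OF that(2,1)] ring_of_integers_mult[OF D] that(1) by (simp add: R_def)
    have w: "w^2 = of_int D" using D(1) by (simp add: w_def)
    have pr: "real_of_int p^2 - of_int D * (of_int q)^2 = 4"
      using arg_cong[OF pq(1), of real_of_int] by simp
    have ar: "2 * real_of_int a' = of_int a * of_int p - w^2 * of_int b * of_int q"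
      "2 * real_of_int b' = of_int b * of_int p - of_int a * of_int q"
      using arg_cong[OF a'b'(1), of real_of_int] arg_cong[OF a'b'(2), of real_of_int] w by simp_all
    have "4 * (u^2 * (of_int a' + of_int b' * w))
        = (of_int p + of_int q * w) * (2 * of_int a' + (2 * of_int b') * w)"
      unfolding u by (simp add: field_simps)
    also have "\<dots> = (of_int p^2 - w^2 * of_int q^2) * (of_int a + of_int b * w)"
      unfolding ar by (simp add: power2_eq_square algebra_simps)
    also have "\<dots> = 4 * (of_int a + of_int b * w)" unfolding w pr ..
    finally have "u^2 * (of_int a' + of_int b' * w) = of_int a + of_int b * w" by simp
    moreover have "4 * (u'^2 * (of_int a' - of_int b' * w))
        = (of_int p - of_int q * w) * (2 * of_int a' - (2 * of_int b') * w)"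
      unfolding u' by (simp add: field_simps)
    then have "4 * (u'^2 * (of_int a' - of_int b' * w))
        = (of_int p^2 - w^2 * of_int q^2) * (of_int a - of_int b * w)"
      unfolding ar by (simp add: power2_eq_square algebra_simps)
    then have "4 * (u'^2 * (of_int a' - of_int b' * w)) = 4 * (of_int a - of_int b * w)"
      unfolding w pr .
    then have "u'^2 * (of_int a' - of_int b' * w) = of_int a - of_int b * w" by simp
    ultimately show ?thesis using mult[OF u(1)] mult[OF u'(1)] IH by metis
  qed
  show ?case
  proof (cases "b \<ge> 0")
    case True
    then show ?thesis using nonneg less.prems by blast
  next
    case False
    then have "?P a (- b)" using less.prems by (intro nonneg) auto
    then show ?thesis by simp
  qed
qed

text \<open>
  The units used are the squares of \<open>1 + w\<close>, \<open>2 + w\<close> and \<open>(1 + w) / 2\<close>, the fundamental units for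
  \<open>D\<close> equal to 2, 3 and 5.
\<close>
lemma doubles_sums_of_squares:
  fixes D a b :: int
  assumes "D = 2 \<or> D = 3 \<or> D = 5" "squarefree D"
    and ab: "4 dvd a^2 - D * b^2" "0 < a" "D * b^2 < a^2"
  shows "sum_of_squares (ring_of_integers (quad_field D)) (of_int a + of_int b * sqrt (of_int D))"
proof -
  let ?R = "ring_of_integers (quad_field D)" and ?w = "sqrt (of_int D)"
  have D: "D \<ge> 2" using assms(1) by auto
  have w: "?w * ?w = of_int D" using D by simp
  note mem = ring_of_integers_memI[OF D]
  note descent = unit_square_descent[OF D assms(2) _ _ _ _ _ _ _ _ _ _ _ _ ab]
  note sos = sum_of_squares_square sum_of_squares_of_nat_mult[of ?R _ 2]
    sum_of_squares_add[OF sum_of_squares_square sum_of_squares_square]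
  have one: "1 \<in> ?R" using mem[of 2 0] by simp
  consider "D = 2" | "D = 3" | "D = 5" using assms(1) by blast
  then show ?thesis
  proof cases
    case 1
    have u: "1 + ?w \<in> ?R" "1 - ?w \<in> ?R"
      using mem[of 2 2] mem[of 2 "-2"] 1 by (simp_all add: add_divide_distrib diff_divide_distrib)
    have "(1 + ?w)^2 = (of_int 6 + of_int 4 * ?w) / 2" "(1 - ?w)^2 = (of_int 6 - of_int 4 * ?w) / 2"
      using 1 w by (simp_all add: power2_eq_square algebra_simps)
    moreover have "sum_of_squares ?R (of_int 2 * (of_int 2 + ?w))"
      "sum_of_squares ?R (of_int 2 * (of_int 2 - ?w))"
      using sos(3)[OF u(1) one] sos(3)[OF u(2) one] 1 w by (simp_all add: power2_eq_square algebra_simps)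
    ultimately show ?thesis
      using descent[of 6 4 "1 + ?w" "1 - ?w" 2 2] u even_coords[OF assms(2)] 1 by simp
  next
    case 2
    have u: "2 + ?w \<in> ?R" "2 - ?w \<in> ?R" "1 + ?w \<in> ?R" "1 - ?w \<in> ?R"
      using mem[of 4 2] mem[of 4 "-2"] mem[of 2 2] mem[of 2 "-2"] 2
      by (simp_all add: add_divide_distrib diff_divide_distrib)
    have "(2 + ?w)^2 = (of_int 14 + of_int 8 * ?w) / 2" "(2 - ?w)^2 = (of_int 14 - of_int 8 * ?w) / 2"
      using 2 w by (simp_all add: power2_eq_square algebra_simps)
    moreover have "sum_of_squares ?R (of_int 2 * (of_int 2 + ?w))"
      "sum_of_squares ?R (of_int 2 * (of_int 2 - ?w))"
      using sos(1)[OF u(3)] sos(1)[OF u(4)] 2 w by (simp_all add: power2_eq_square algebra_simps)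
    ultimately show ?thesis
      using descent[of 14 8 "2 + ?w" "2 - ?w" 2 2] u even_coords[OF assms(2)] 2 by simp
  next
    case 3
    let ?u = "(1 + ?w) / 2" and ?u' = "(1 - ?w) / 2"
    have u: "?u \<in> ?R" "?u' \<in> ?R"
      using mem[of 1 1] mem[of 1 "-1"] 3 by simp_all
    have "?u^2 = (of_int 3 + of_int 1 * ?w) / 2" "?u'^2 = (of_int 3 - of_int 1 * ?w) / 2"
      using 3 w by (simp_all add: power2_eq_square field_simps)
    moreover have "sum_of_squares ?R (of_int 1 * (of_int 5 + ?w))"
      "sum_of_squares ?R (of_int 1 * (of_int 5 - ?w))"
    proof -
      have "of_nat 2 * (?u^2 + 1^2) = of_int 1 * (of_int 5 + ?w)"
        "of_nat 2 * (?u'^2 + 1^2) = of_int 1 * (of_int 5 - ?w)"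
        using 3 w by (simp_all add: power2_eq_square field_simps)
      then show "sum_of_squares ?R (of_int 1 * (of_int 5 + ?w))"
        "sum_of_squares ?R (of_int 1 * (of_int 5 - ?w))"
        using sos(2)[OF sos(3)[OF u(1) one]] sos(2)[OF sos(3)[OF u(2) one]] by (simp_all only:)
    qed
    ultimately show ?thesis
      using descent[of 3 1 ?u ?u' 5 1] u 3 by simp
  qed
qed

theorem theorem3:
  fixes D :: int and K :: "real set"
  assumes "D \<ge> 2" and "squarefree D"
    and "K = quad_field D"
  shows "(\<forall>\<beta> \<in> {2 * \<alpha> | \<alpha>. \<alpha> \<in> totally_positive_integers K}.
            sum_of_squares (ring_of_integers K) \<beta>)
         \<longleftrightarrow> D = 2 \<or> D = 3 \<or> D = 5"
proof
  assume L: "\<forall>\<beta> \<in> {2 * \<alpha> | \<alpha>. \<alpha> \<in> totally_positive_integers K}.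
            sum_of_squares (ring_of_integers K) \<beta>"
  show "D = 2 \<or> D = 3 \<or> D = 5"
  proof (rule doubles_sums_of_squares_imp[OF assms(1,2)])
    fix a b :: int
    assume ab: "4 dvd a^2 - D * b^2" "0 < a" "D * b^2 < a^2"
    let ?x = "(of_int a + of_int b * sqrt (of_int D)) / 2"
    have "?x \<in> totally_positive_integers K"
      using ab ring_of_integers_memI[OF assms(1) ab(1)] totally_positive_iff[OF assms(1,2) ab(1)]
      by (simp add: totally_positive_integers_def assms(3))
    with L have "sum_of_squares (ring_of_integers K) (2 * ?x)" by blast
    then show "sum_of_squares (ring_of_integers (quad_field D)) (of_int a + of_int b * sqrt (of_int D))"
      unfolding assms(3) by (simp only: nonzero_mult_div_cancel_left times_divide_eq_right zero_neq_numeral not_False_eq_True)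
  qed
next
  assume R: "D = 2 \<or> D = 3 \<or> D = 5"
  show "\<forall>\<beta> \<in> {2 * \<alpha> | \<alpha>. \<alpha> \<in> totally_positive_integers K}.
            sum_of_squares (ring_of_integers K) \<beta>"
  proof
    fix \<beta> assume "\<beta> \<in> {2 * \<alpha> | \<alpha>. \<alpha> \<in> totally_positive_integers K}"
    then obtain \<alpha> where \<alpha>: "\<beta> = 2 * \<alpha>" "\<alpha> \<in> ring_of_integers K" "totally_positive K \<alpha>"
      by (auto simp: totally_positive_integers_def)
    obtain a b where x: "\<alpha> = (of_int a + of_int b * sqrt (of_int D)) / 2" "4 dvd a^2 - D * b^2"
      using ring_of_integers_memE[OF assms(1,2)] \<alpha>(2) assms(3) by blast
    then have "0 < a \<and> D * b^2 < a^2"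
      using totally_positive_iff[OF assms(1,2) x(2)] \<alpha>(3) unfolding assms(3) x(1) by blast
    then show "sum_of_squares (ring_of_integers K) \<beta>"
      using doubles_sums_of_squares[OF R assms(2) x(2)] unfolding \<alpha>(1) x(1) assms(3)
      by (simp only: nonzero_mult_div_cancel_left times_divide_eq_right zero_neq_numeral not_False_eq_True)
  qed
qed

end
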